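(* Let $G$ be a weighted graph on $[n]$ (as described in the context), let $\theta\in\mathbb{R}$, and let $i\in\partial 0_{\theta,G}$. Then for every vertex $j\neq i$, \[\alpha_j(G\setminus i)(\theta)=\alpha_j(G)(\theta),\quad\text{i.e.}\quad \frac{\mu(G\setminus i)}{\mu(G\setminus i,j)}(\theta)=\frac{\mu(G)}{\mu(G\setminus j)}(\theta).\] In particular: $-_{\theta,G\setminus i}=-_{\theta,G}$, $0_{\theta,G\setminus i}=0_{\theta,G}$, $+_{\theta,G\setminus i}=+_{\theta,G}$ and $\infty_{\theta,G\setminus i}=\infty_{\theta,G}\setminus\{i\}$.
   Context: A weighted graph $G$ on vertex set $[n]=\{1,\dots,n\}$ is the complete graph on $[n]$ where vertex $i$ carries weight $x-r_i$ ($r_i\in\mathbb{R}$, $x$ an indeterminate) and each pair $\{j,k\}$ carries a real weight $\lambda_{jk}=\lambda_{kj}\le 0$; $j$ and $k$ are neighbors if $\lambda_{jk}\neq 0$. Its matching polynomial is $\mu(G)(x)=\sum_{M}\prod_{i\notin M}(x-r_i)\prod_{jk\in M}\lambda_{jk}$, the sum over all matchings $M$ (sets of pairwise disjoint pairs) of the complete graph on $[n]$, where $i\notin M$ means $i$ is covered by no pair of $M$; $\mu(\emptyset)=1$. For a set $S$ of vertices, $G\setminus S$ (written e.g. $G\setminus i$, $G\setminus i,j$) is the weighted graph on $[n]\setminus S$ with the restricted weights. For a vertex $j$, $\alpha_j(G):=\mu(G)/\mu(G\setminus j)$, a real rational function of $x$; for $\theta\in\mathbb{R}$, $\alpha_j(G)(\theta)\in\mathbb{R}\cup\{\infty\}$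 is the value of this rational function at $\theta$ (after cancellation of common factors), equal to $\infty$ at a pole. For $\theta\in\mathbb{R}$ the vertex set is partitioned into $-_{\theta,G},0_{\theta,G},+_{\theta,G},\infty_{\theta,G}$ according as $\alpha_j(G)(\theta)$ is negative, zero, positive, or $\infty$. For a set $A$ of vertices, its frontier $\partial A$ is the set of vertices not in $A$ having a neighbor in $A$. *)

theory Defs
  imports
    "HOL-Computational_Algebra.Computational_Algebra"
    "HOL-Computational_Algebra.Field_as_Ring"
begin

text \<open>
  Vertex \<open>i\<close> carries the weight \<open>x - root G i\<close>. Pair weights are indexed by two-element
  sets, \<open>pair_weight G {j, k}\<close> being $\lambda_{jk} = \lambda_{kj}$; only values at vertices
  and pairs of vertices of \<open>G\<close> are relevant.
\<close>

record wgraph =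
  verts :: "nat set"
  root :: "nat \<Rightarrow> real"
  pair_weight :: "nat set \<Rightarrow> real"

definition weighted_graph :: "nat \<Rightarrow> wgraph \<Rightarrow> bool" where
  "weighted_graph n G \<longleftrightarrow>
     verts G = {1..n} \<and>
     (\<forall>j\<in>verts G. \<forall>k\<in>verts G. j \<noteq> k \<longrightarrow> pair_weight G {j, k} \<le> 0)"

definition neighbors :: "wgraph \<Rightarrow> nat \<Rightarrow> nat \<Rightarrow> bool" where
  "neighbors G j k \<longleftrightarrow>
     j \<in> verts G \<and> k \<in> verts G \<and> j \<noteq> k \<and> pair_weight G {j, k} \<noteq> 0"

definition del_verts :: "wgraph \<Rightarrow> nat set \<Rightarrow> wgraph" where
  "del_verts G S = G\<lparr>verts := verts G - S\<rparr>"

text \<open>All matchings of the complete graph on \<open>V\<close>; pairs of weight zero are allowed.\<close>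

definition matchings :: "nat set \<Rightarrow> nat set set set" where
  "matchings V = {M. (\<forall>e\<in>M. e \<subseteq> V \<and> card e = 2) \<and> pairwise disjnt M}"

definition matching_poly :: "wgraph \<Rightarrow> real poly" where
  "matching_poly G =
     (\<Sum>M\<in>matchings (verts G).
        (\<Prod>i\<in>verts G - \<Union>M. [:- root G i, 1:]) * (\<Prod>e\<in>M. [:pair_weight G e:]))"

text \<open>The set $\mathbb{R} \cup \{\infty\}$, with a single unsigned point at infinity.\<close>

datatype ext_val = Finite real | Infinite

text \<open>
  The value of a rational function after cancellation: \<^const>\<open>quot_of_fract\<close> returns a coprime
  numerator and denominator.
\<close>

definition fract_value :: "real poly fract \<Rightarrow> real \<Rightarrow> ext_val" where
  "fract_value f \<theta> =
     (let (p, q) = quot_of_fract f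
      in if poly q \<theta> = 0 then Infinite else Finite (poly p \<theta> / poly q \<theta>))"

definition alpha :: "wgraph \<Rightarrow> nat \<Rightarrow> real poly fract" where
  "alpha G j = Fract (matching_poly G) (matching_poly (del_verts G {j}))"

definition neg_set :: "real \<Rightarrow> wgraph \<Rightarrow> nat set" where
  "neg_set \<theta> G = {j \<in> verts G. \<exists>a<0. fract_value (alpha G j) \<theta> = Finite a}"

definition zero_set :: "real \<Rightarrow> wgraph \<Rightarrow> nat set" where
  "zero_set \<theta> G = {j \<in> verts G. fract_value (alpha G j) \<theta> = Finite 0}"

definition pos_set :: "real \<Rightarrow> wgraph \<Rightarrow> nat set" where
  "pos_set \<theta> G = {j \<in> verts G. \<exists>a>0. fract_value (alpha G j) \<theta> = Finite a}"

definition inf_set :: "real \<Rightarrow> wgraph \<Rightarrow> nat set" where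
  "inf_set \<theta> G = {j \<in> verts G. fract_value (alpha G j) \<theta> = Infinite}"

definition vertex_frontier :: "wgraph \<Rightarrow> nat set \<Rightarrow> nat set" where
  "vertex_frontier G A = {v \<in> verts G - A. \<exists>u\<in>A. neighbors G v u}"

end

theory Submission
  imports Defs
begin

text \<open>
  Write \<open>ord S\<close> for the multiplicity of \<open>\<theta>\<close> as a root of the matching polynomial on the vertex
  set \<open>S\<close>. Deleting a vertex changes it by at most one, and \<open>j\<close> lies in the zero set iff its
  deletion decreases it. For all real vertex weights the Rayleigh inequality
  \<open>\<mu>(G - k) \<mu>(G - l) - \<mu>(G) \<mu>(G - k, l) \<ge> 0\<close> holds on the real line, so its left-hand side
  vanishes to even order at \<open>\<theta>\<close>.

  If \<open>i\<close> has a neighbor \<open>k\<close> in the zero set, this parity forces \<open>ord (G - i) = ord G + 1\<close> and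
  puts \<open>k\<close> into the zero set of \<open>H = G - i\<close>; expanding \<open>\<mu>(G - k)\<close> at \<open>i\<close> yields a second
  neighbor \<open>l\<close> of \<open>i\<close> with \<open>ord (H - k, l) = ord H - 2\<close>. The sets whose deletion lowers the
  multiplicity by their cardinality behave like independent sets of a matroid, so any \<open>j\<close> in the
  zero set of \<open>H\<close> is independent of \<open>k\<close> or of \<open>l\<close>, which puts \<open>j\<close> into the zero set of \<open>G\<close>.
  For all other \<open>j\<close> the Rayleigh difference for \<open>i, j\<close> vanishes to order at least
  \<open>2 ord G + 1\<close>, hence by parity to a higher order, and this is the equality of the two values.
\<close>

subsection \<open>Matching polynomials of vertex subsets\<close>

text \<open>The pair weights stay fixed, while deletions shrink the vertex set and
  \<open>exchange\<close> perturbs a root; hence the three are separate arguments.\<close>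

definition mu :: "(nat set \<Rightarrow> real) \<Rightarrow> (nat \<Rightarrow> real) \<Rightarrow> nat set \<Rightarrow> real poly" where
  "mu w r S = matching_poly \<lparr>verts = S, root = r, pair_weight = w\<rparr>"

lemma matching_poly_conv_mu: "matching_poly G = mu (pair_weight G) (root G) (verts G)"
  by (simp add: mu_def matching_poly_def)

lemma matching_poly_del_verts:
  "matching_poly (del_verts G T) = mu (pair_weight G) (root G) (verts G - T)"
  by (simp add: matching_poly_conv_mu del_verts_def)

lemma mu_altdef:
  "mu w r S = (\<Sum>M\<in>matchings S. (\<Prod>i\<in>S - \<Union>M. [:- r i, 1:]) * (\<Prod>e\<in>M. [:w e:]))"
  by (simp add: mu_def matching_poly_def)

lemma finite_matchings: "finite S \<Longrightarrow> finite (matchings S)"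
  by (rule finite_subset[of _ "Pow (Pow S)"]) (auto simp: matchings_def)

text \<open>Either \<open>v\<close> is uncovered, or a unique pair \<open>{v, l}\<close> covers it
  and the remaining pairs avoid both \<open>v\<close> and \<open>l\<close>.\<close>

lemma matchings_split:
  assumes "v \<in> S"
  shows "matchings S =
    matchings (S - {v}) \<union> (\<Union>l\<in>S - {v}. insert {v, l} ` matchings (S - {v, l}))"
proof (intro equalityI subsetI)
  fix M assume M: "M \<in> matchings S"
  show "M \<in> matchings (S - {v}) \<union> (\<Union>l\<in>S - {v}. insert {v, l} ` matchings (S - {v, l}))"
  proof (cases "v \<in> \<Union>M")
    case False
    then show ?thesis using M by (auto simp: matchings_def)
  next
    case True
    then obtain e where e: "e \<in> M" "v \<in> e" by auto
    with M have "card e = 2" "e \<subseteq> S" by (auto simp: matchings_def)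
    with e obtain l where l: "e = {v, l}" "l \<noteq> v" by (auto simp: card_2_iff)
    have "disjnt f e" if "f \<in> M - {e}" for f
      using that M e by (auto simp: matchings_def pairwise_def)
    then have "M - {e} \<in> matchings (S - {v, l})"
      using M l unfolding matchings_def pairwise_def disjnt_def by blast
    moreover have "M = insert {v, l} (M - {e})" using e l by auto
    ultimately have "M \<in> insert {v, l} ` matchings (S - {v, l})" by (rule rev_image_eqI)
    then show ?thesis using l \<open>e \<subseteq> S\<close> by blast
  qed
next
  fix M assume "M \<in> matchings (S - {v}) \<union> (\<Union>l\<in>S - {v}. insert {v, l} ` matchings (S - {v, l}))"
  then show "M \<in> matchings S"
  proof
    assume "M \<in> matchings (S - {v})"
    then show ?thesis by (auto simp: matchings_def)
  next
    assume "M \<in> (\<Union>l\<in>S - {v}. insert {v, l} ` matchings (S - {v, l}))"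
    then obtain l M' where l: "l \<in> S" "l \<noteq> v" and M': "M' \<in> matchings (S - {v, l})"
      and M: "M = insert {v, l} M'" by auto
    have "pairwise disjnt M"
      using M' unfolding M matchings_def pairwise_def disjnt_def by blast
    moreover have "\<forall>e\<in>M. e \<subseteq> S \<and> card e = 2"
      using M' l assms unfolding M matchings_def by (auto simp: card_2_iff)
    ultimately show ?thesis by (simp add: matchings_def)
  qed
qed

text \<open>The vertex recursion for matching polynomials: matchings are grouped by the partner of
  \<open>v\<close>, if there is one.\<close>

lemma mu_expand:
  assumes "finite S" "v \<in> S"
  shows "mu w r S = [:- r v, 1:] * mu w r (S - {v})
           + (\<Sum>l\<in>S - {v}. [:w {v, l}:] * mu w r (S - {v, l}))"
proof -
  define t where "t T M = (\<Prod>i\<in>T - \<Union>M. [:- r i, 1:]) * (\<Prod>e\<in>M. [:w e:])" for T and M :: "nat set set"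
  have mu: "mu w r T = sum (t T) (matchings T)" for T
    by (simp add: mu_altdef t_def)
  have notin: "v \<notin> \<Union>M" if "M \<in> matchings (S - {v})" for M
    using that by (auto simp: matchings_def)
  have inj: "inj_on (insert {v, l}) (matchings (S - {v, l}))" for l
  proof (rule inj_onI)
    fix M N assume "M \<in> matchings (S - {v, l})" "N \<in> matchings (S - {v, l})"
      and eq: "insert {v, l} M = insert {v, l} N"
    then have "{v, l} \<notin> M" "{v, l} \<notin> N" by (auto simp: matchings_def)
    with eq show "M = N" by (simp add: insert_ident)
  qed
  have disj: "insert {v, l} ` matchings (S - {v, l}) \<inter> insert {v, l'} ` matchings (S - {v, l'}) = {}"
    if "l \<noteq> l'" for l l'
  proof -
    have "{v, l} \<noteq> {v, l'}" using that by (auto simp: doubleton_eq_iff)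
    moreover have "{v, l} \<notin> M" if "M \<in> matchings (S - {v, l'})" for M
      using that by (auto simp: matchings_def)
    ultimately show ?thesis by blast
  qed
  have "mu w r S = sum (t S) (matchings (S - {v}))
      + sum (t S) (\<Union>l\<in>S - {v}. insert {v, l} ` matchings (S - {v, l}))"
    unfolding mu matchings_split[OF assms(2)]
  proof (rule sum.union_disjoint)
    show "matchings (S - {v}) \<inter> (\<Union>l\<in>S - {v}. insert {v, l} ` matchings (S - {v, l})) = {}"
      using notin by blast
  qed (use assms(1) in \<open>auto simp: finite_matchings\<close>)
  also have "sum (t S) (matchings (S - {v})) = [:- r v, 1:] * mu w r (S - {v})"
    unfolding mu sum_distrib_left
  proof (rule sum.cong)
    fix M assume "M \<in> matchings (S - {v})"
    then have "S - \<Union>M = insert v (S - {v} - \<Union>M)" using notin assms(2) by auto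
    then show "t S M = [:- r v, 1:] * t (S - {v}) M"
      unfolding t_def using assms(1) by (simp add: mult.assoc del: mult_pCons_left)
  qed simp
  also have "sum (t S) (\<Union>l\<in>S - {v}. insert {v, l} ` matchings (S - {v, l}))
      = (\<Sum>l\<in>S - {v}. sum (t S) (insert {v, l} ` matchings (S - {v, l})))"
    using assms(1) disj by (intro sum.UNION_disjoint) (auto simp: finite_matchings)
  also have "\<dots> = (\<Sum>l\<in>S - {v}. [:w {v, l}:] * mu w r (S - {v, l}))"
  proof (rule sum.cong)
    fix l assume l: "l \<in> S - {v}"
    show "sum (t S) (insert {v, l} ` matchings (S - {v, l})) = [:w {v, l}:] * mu w r (S - {v, l})"
      unfolding mu sum_distrib_left sum.reindex[OF inj] o_def
    proof (rule sum.cong)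
      fix M assume M: "M \<in> matchings (S - {v, l})"
      have "{v, l} \<notin> M" using M by (auto simp: matchings_def)
      moreover have "finite M"
        by (rule finite_subset[of _ "Pow S"]) (use M assms(1) in \<open>auto simp: matchings_def\<close>)
      moreover have "S - \<Union>(insert {v, l} M) = S - {v, l} - \<Union>M" by auto
      ultimately show "t S (insert {v, l} M) = [:w {v, l}:] * t (S - {v, l}) M"
        unfolding t_def by (simp add: mult_ac del: mult_pCons_left mult_pCons_right)
    qed simp
  qed simp
  finally show ?thesis .
qed

lemma mu_empty [simp]: "mu w r {} = 1"
proof -
  have "matchings {} = {{}}" by (auto simp: matchings_def)
  then show ?thesis by (simp add: mu_altdef)
qed

text \<open>Serves to show that \<open>mu\<close> is never the zero polynomial. In the vertex
  recursion only the term with the linear factor reaches degree \<open>card S\<close>.\<close>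

lemma mu_monic:
  assumes "finite S"
  shows "degree (mu w r S) \<le> card S \<and> coeff (mu w r S) (card S) = 1"
  using assms
proof (induction "card S" arbitrary: S rule: less_induct)
  case less
  show ?case
  proof (cases "S = {}")
    case False
    then obtain v where v: "v \<in> S" by auto
    define n where "n = card (S - {v})"
    have S: "card S = Suc n" unfolding n_def using v less.prems by (metis card_Suc_Diff1)
    have 1: "degree (mu w r (S - {v})) \<le> n" "coeff (mu w r (S - {v})) n = 1"
      using less.hyps[of "S - {v}"] less.prems S by (auto simp: n_def)
    have 2: "degree ([:w {v, l}:] * mu w r (S - {v, l})) \<le> n" if "l \<in> S - {v}" for l
    proof -
      have "card (S - {v, l}) \<le> n"
        unfolding n_def using less.prems by (intro card_mono) auto
      then have "degree (mu w r (S - {v, l})) \<le> n"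
        using less.hyps[of "S - {v, l}"] less.prems S by fastforce
      then show ?thesis using degree_smult_le[of "w {v, l}"] by (simp add: order_trans)
    qed
    define R where "R = (\<Sum>l\<in>S - {v}. [:w {v, l}:] * mu w r (S - {v, l}))"
    have R: "degree R \<le> n"
      unfolding R_def using less.prems 2 by (intro degree_sum_le) auto
    have eq: "mu w r S = pCons 0 (mu w r (S - {v})) + (smult (- r v) (mu w r (S - {v})) + R)"
      using mu_expand[OF less.prems v] by (simp add: R_def)
    have "degree (mu w r S) \<le> Suc n"
      unfolding eq using R 1 degree_smult_le[of "- r v" "mu w r (S - {v})"]
      by (intro degree_add_le) (auto intro: order_trans degree_pCons_le)
    moreover have "coeff (mu w r S) (Suc n) = 1"
      unfolding eq using R 1 by (simp add: coeff_eq_0)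
    ultimately show ?thesis using S by simp
  qed simp
qed

lemma mu_nonzero: "finite S \<Longrightarrow> mu w r S \<noteq> 0"
  using mu_monic[of S w r] by auto

text \<open>Induction through the recursion at one fixed \<open>v\<close>. Expanding each
  \<open>mu w r (S - {u})\<close> with \<open>u\<close> distinct from \<open>v\<close> gives sums
  that, after an interchange of summation, are the derivatives supplied by the induction hypothesis
  for \<open>S - {v}\<close> and \<open>S - {v, l}\<close>.\<close>

lemma pderiv_mu:
  assumes "finite S"
  shows "pderiv (mu w r S) = (\<Sum>v\<in>S. mu w r (S - {v}))"
  using assms
proof (induction "card S" arbitrary: S rule: less_induct)
  case less
  show ?case
  proof (cases "S = {}")
    case False
    then obtain v where v: "v \<in> S" by auto
    let ?x = "[:- r v, 1:]"
    have smaller: "card (S - T) < card S" if "v \<in> T" for T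
      using less.prems v that by (intro psubset_card_mono) auto
    have a: "(\<Sum>u\<in>S - {v}. mu w r (S - {u})) = (\<Sum>u\<in>S - {v}. ?x * mu w r (S - {v, u})
        + (\<Sum>l\<in>S - {v} - {u}. [:w {v, l}:] * mu w r (S - {v, u, l})))"
    proof (rule sum.cong)
      fix u assume "u \<in> S - {v}"
      then show "mu w r (S - {u}) = ?x * mu w r (S - {v, u})
        + (\<Sum>l\<in>S - {v} - {u}. [:w {v, l}:] * mu w r (S - {v, u, l}))"
        using mu_expand[of "S - {u}" v w r] less.prems v
        by (simp add: Diff_insert2[symmetric] insert_commute del: mult_pCons_left)
    qed simp
    have b: "(\<Sum>u\<in>S - {v}. \<Sum>l\<in>S - {v} - {u}. [:w {v, l}:] * mu w r (S - {v, u, l}))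
        = (\<Sum>l\<in>S - {v}. \<Sum>u\<in>S - {v} - {l}. [:w {v, l}:] * mu w r (S - {v, u, l}))"
    proof -
      have "S - {v} - {u} = {l \<in> S - {v}. l \<noteq> u}" for u by auto
      moreover have "S - {v} - {l} = {u \<in> S - {v}. l \<noteq> u}" for l by auto
      ultimately show ?thesis
        using sum.swap_restrict[of "S - {v}" "S - {v}"
            "\<lambda>u l. [:w {v, l}:] * mu w r (S - {v, u, l})" "\<lambda>u l. l \<noteq> u"] less.prems
        by simp
    qed
    have c: "pderiv ([:w {v, l}:] * mu w r (S - {v, l}))
        = (\<Sum>u\<in>S - {v} - {l}. [:w {v, l}:] * mu w r (S - {v, u, l}))" if "l \<in> S - {v}" for l
    proof -
      have "pderiv (mu w r (S - {v, l})) = (\<Sum>u\<in>S - {v, l}. mu w r (S - {v, l} - {u}))"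
        using less.prems by (intro less.hyps smaller) auto
      also have "\<dots> = (\<Sum>u\<in>S - {v} - {l}. mu w r (S - {v, u, l}))"
        by (intro sum.cong) (auto intro!: arg_cong[where f = "mu w r"])
      finally show ?thesis unfolding sum_distrib_left[symmetric] by (simp add: pderiv_smult)
    qed
    have d: "pderiv (mu w r (S - {v})) = (\<Sum>u\<in>S - {v}. mu w r (S - {v, u}))"
    proof -
      have "pderiv (mu w r (S - {v})) = (\<Sum>u\<in>S - {v}. mu w r (S - {v} - {u}))"
        using less.prems by (intro less.hyps smaller) auto
      then show ?thesis by (simp add: Diff_insert2[symmetric] insert_commute)
    qed
    have "pderiv (mu w r S) = mu w r (S - {v}) + ?x * pderiv (mu w r (S - {v}))
       + (\<Sum>l\<in>S - {v}. pderiv ([:w {v, l}:] * mu w r (S - {v, l})))"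
      unfolding mu_expand[OF less.prems v]
      by (simp add: pderiv_add pderiv_mult higher_pderiv_sum[of 1, simplified] pderiv_pCons
          del: mult_pCons_left)
    also have "\<dots> = mu w r (S - {v}) + (\<Sum>u\<in>S - {v}. mu w r (S - {u}))"
      unfolding a sum.distrib b d sum_distrib_left using c
      by (simp add: add_ac del: mult_pCons_left)
    also have "\<dots> = (\<Sum>u\<in>S. mu w r (S - {u}))"
      using less.prems v by (simp add: sum.remove)
    finally show ?thesis .
  qed simp
qed


text \<open>In the expansion at \<open>j\<close>, the root \<open>r j\<close> occurs only in the
  linear factor, so \<open>mu\<close> is affine in it.\<close>

lemma mu_root_shift:
  assumes "finite S"
  shows "mu w (r(j := r j - c)) S = mu w r S + (if j \<in> S then [:c:] * mu w r (S - {j}) else 0)"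
proof -
  have indep: "mu w (r(j := y)) T = mu w r T" if "j \<notin> T" for T y
    unfolding mu_altdef using that by (intro sum.cong arg_cong2[where f = "(*)"] prod.cong) auto
  show ?thesis
  proof (cases "j \<in> S")
    case True
    have "[:c - r j, 1:] = [:- r j, 1:] + [:c:]" by simp
    then have shift: "[:c - r j, 1:] * p = [:- r j, 1:] * p + [:c:] * p" for p
      by (metis distrib_right)
    show ?thesis
      unfolding mu_expand[OF assms True]
      using True by (simp add: indep shift del: mult_pCons_left)
  qed (simp add: indep)
qed

section \<open>Rayleigh and Wronskian inequalities for nonpositive pair weights\<close>

locale matching_weights =
  fixes V :: "nat set" and w :: "nat set \<Rightarrow> real"
  assumes finite_V: "finite V"
    and nonpos: "j \<in> V \<Longrightarrow> k \<in> V \<Longrightarrow> j \<noteq> k \<Longrightarrow> w {j, k} \<le> 0"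
begin

lemma finite_sub: "S \<subseteq> V \<Longrightarrow> finite S"
  using finite_V finite_subset by blast

text \<open>
  Expanding both \<open>mu w r S\<close> and \<open>mu w r (S - {l})\<close> at \<open>k\<close> expresses the difference as a
  nonnegative combination of a square and of the same differences for \<open>S - {k}\<close>.
\<close>

lemma rayleigh:
  assumes "S \<subseteq> V" "k \<in> S" "l \<in> S" "k \<noteq> l"
  shows "poly (mu w r S) x * poly (mu w r (S - {k, l})) x
       \<le> poly (mu w r (S - {k})) x * poly (mu w r (S - {l})) x"
  using assms
proof (induction "card S" arbitrary: S k rule: less_induct)
  case less
  define f where "f T = poly (mu w r T) x" for T
  define W where "W = S - {k}"
  have fin: "finite S" using less.prems finite_sub by blast
  have l: "l \<in> W" using less.prems by (auto simp: W_def)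
  have sets: "S - {k} = W" "S - {k, l} = W - {l}" by (auto simp: W_def)
  have f_expand: "f T = (x - r v) * f (T - {v}) + (\<Sum>s\<in>T - {v}. w {v, s} * f (T - {v, s}))"
    if "finite T" "v \<in> T" for T v
    unfolding f_def mu_expand[OF that] by (simp add: poly_sum algebra_simps)
  \<comment> \<open>The term at \<open>l\<close> is split off because it has no counterpart in
    \<open>2\<close>. It yields the square; the other terms pair up by \<open>s\<close> into
    Rayleigh differences for \<open>W\<close>.\<close>
  have 1: "f S = (x - r k) * f W + w {k, l} * f (W - {l}) + (\<Sum>s\<in>W - {l}. w {k, s} * f (W - {s}))"
  proof -
    have "f S = (x - r k) * f W + (\<Sum>s\<in>W. w {k, s} * f (W - {s}))"
      using f_expand[of S k] fin less.prems
      by (simp add: W_def Diff_insert2[symmetric] insert_commute)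
    also have "(\<Sum>s\<in>W. w {k, s} * f (W - {s}))
        = w {k, l} * f (W - {l}) + (\<Sum>s\<in>W - {l}. w {k, s} * f (W - {s}))"
      using l fin by (intro sum.remove) (auto simp: W_def)
    finally show ?thesis by simp
  qed
  have 2: "f (S - {l}) = (x - r k) * f (W - {l}) + (\<Sum>s\<in>W - {l}. w {k, s} * f (W - {s, l}))"
  proof -
    have "S - {l} - {k} = W - {l}" "S - {l} - {k, s} = W - {s, l}" for s by (auto simp: W_def)
    then show ?thesis using f_expand[of "S - {l}" k] fin less.prems by simp
  qed
  have 3: "0 \<le> - w {k, s} * (f (W - {s}) * f (W - {l}) - f W * f (W - {s, l}))"
    if "s \<in> W - {l}" for s
  proof (rule mult_nonneg_nonneg)
    show "0 \<le> - w {k, s}" using nonpos[of k s] that less.prems by (auto simp: W_def)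
    have "card W < card S"
      unfolding W_def using less.prems fin by (intro card_Diff1_less)
    then show "0 \<le> f (W - {s}) * f (W - {l}) - f W * f (W - {s, l})"
      using less.hyps[of W s] that l less.prems by (auto simp: f_def W_def)
  qed
  have "f W * f (S - {l}) - f S * f (W - {l}) = - w {k, l} * (f (W - {l}))\<^sup>2
      + (\<Sum>s\<in>W - {l}. - w {k, s} * (f (W - {s}) * f (W - {l}) - f W * f (W - {s, l})))"
    unfolding 1 2 right_diff_distrib sum_subtractf
    by (simp add: algebra_simps power2_eq_square sum_distrib_left sum_negf)
  also have "\<dots> \<ge> 0"
    using nonpos[of k l] less.prems
    by (intro add_nonneg_nonneg mult_nonneg_nonneg sum_nonneg[OF 3]) auto
  finally show ?case unfolding sets f_def by simp
qed

text \<open>By \<open>pderiv_mu\<close> both derivatives are sums over deleted vertices. The vertex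
  \<open>v\<close> contributes the square, every other one a Rayleigh difference.\<close>

lemma wronskian:
  assumes "S \<subseteq> V" "v \<in> S"
  shows "(poly (mu w r (S - {v})) x)\<^sup>2
       \<le> poly (pderiv (mu w r S) * mu w r (S - {v}) - mu w r S * pderiv (mu w r (S - {v}))) x"
proof -
  define f where "f T = poly (mu w r T) x" for T
  have fin: "finite S" using assms finite_sub by blast
  have "poly (pderiv (mu w r S)) x = (\<Sum>u\<in>S. f (S - {u}))"
    using pderiv_mu[OF fin] by (simp add: f_def poly_sum)
  also have "\<dots> = f (S - {v}) + (\<Sum>u\<in>S - {v}. f (S - {u}))"
    using fin assms by (intro sum.remove)
  finally have 1: "poly (pderiv (mu w r S)) x = \<dots>" .
  have 2: "poly (pderiv (mu w r (S - {v}))) x = (\<Sum>u\<in>S - {v}. f (S - {u, v}))"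
    using pderiv_mu[of "S - {v}" w r] fin by (simp add: f_def poly_sum Diff_insert2[symmetric] insert_commute)
  have "poly (pderiv (mu w r S) * mu w r (S - {v}) - mu w r S * pderiv (mu w r (S - {v}))) x
      = (f (S - {v}))\<^sup>2 + (\<Sum>u\<in>S - {v}. f (S - {u}) * f (S - {v}) - f S * f (S - {u, v}))"
    unfolding poly_diff poly_mult 1 2 f_def[symmetric] sum_subtractf
    by (simp add: algebra_simps power2_eq_square sum_distrib_left)
  moreover have "(\<Sum>u\<in>S - {v}. f (S - {u}) * f (S - {v}) - f S * f (S - {u, v})) \<ge> 0"
    using rayleigh[OF assms(1), of _ v r x] assms by (intro sum_nonneg) (auto simp: f_def)
  ultimately show ?thesis by (simp add: f_def)
qed

end

subsection \<open>Orders of vanishing\<close>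

lemma poly_nonneg_at_limit:
  fixes R :: "real poly"
  assumes "\<And>x. x \<noteq> \<theta> \<Longrightarrow> 0 \<le> poly R x"
  shows "0 \<le> poly R \<theta>"
proof (rule tendsto_lowerbound)
  show "(poly R \<longlongrightarrow> poly R \<theta>) (at \<theta>)" by (rule isContD) simp
  show "\<forall>\<^sub>F x in at \<theta>. 0 \<le> poly R x"
    using assms by (auto simp: eventually_at_filter)
qed simp

text \<open>The even power is positive away from \<open>\<theta>\<close>, so it can be divided out
  there; continuity covers \<open>\<theta>\<close> itself.\<close>

lemma nonneg_even_cofactor:
  fixes R :: "real poly"
  assumes "\<And>x. 0 \<le> poly ([:-\<theta>, 1:] ^ (2 * n) * R) x"
  shows "0 \<le> poly R \<theta>"
proof (rule poly_nonneg_at_limit)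
  fix x assume "x \<noteq> \<theta>"
  then have "0 < (x - \<theta>) ^ (2 * n)" by (simp add: power_mult)
  then show "0 \<le> poly R x"
    using assms[of x] by (simp add: zero_le_mult_iff)
qed

text \<open>The odd power changes sign at \<open>\<theta>\<close>, so \<open>R\<close> must do so
  too in the weak sense, and continuity makes it vanish there.\<close>

lemma nonneg_odd_cofactor:
  fixes R :: "real poly"
  assumes "\<And>x. 0 \<le> poly ([:-\<theta>, 1:] ^ (2 * n + 1) * R) x"
  shows "poly R \<theta> = 0"
proof -
  have *: "0 \<le> (x - \<theta>) * poly R x" for x
  proof (cases "x = \<theta>")
    case False
    then have "0 < (x - \<theta>) ^ (2 * n)" by (simp add: power_mult)
    moreover have "poly ([:-\<theta>, 1:] ^ (2 * n + 1) * R) x = (x - \<theta>) ^ (2 * n) * ((x - \<theta>) * poly R x)"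
      by (simp add: algebra_simps)
    ultimately show ?thesis using assms[of x] by (metis mult_le_cancel_left_pos mult_zero_right)
  qed simp
  have right: "0 \<le> poly R x" if "x > \<theta>" for x using *[of x] that by (simp add: zero_le_mult_iff)
  have left: "poly R x \<le> 0" if "x < \<theta>" for x using *[of x] that by (simp add: zero_le_mult_iff)
  have "((\<lambda>x. poly R x) \<longlongrightarrow> poly R \<theta>) (at_right \<theta>)" "((\<lambda>x. poly R x) \<longlongrightarrow> poly R \<theta>) (at_left \<theta>)"
    by (auto intro!: tendsto_eq_intros)
  moreover have "\<forall>\<^sub>F x in at_right \<theta>. 0 \<le> poly R x"
    using right by (simp add: eventually_at_filter)
  moreover have "\<forall>\<^sub>F x in at_left \<theta>. poly R x \<le> 0"
    using left by (simp add: eventually_at_filter)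
  ultimately show ?thesis
    using tendsto_lowerbound[of "poly R" "poly R \<theta>" "at_right \<theta>" 0]
      tendsto_upperbound[of "poly R" "poly R \<theta>" "at_left \<theta>" 0] by force
qed

lemma order_eq_cofactor:
  fixes P :: "real poly"
  assumes "p = [:-\<theta>, 1:] ^ n * P" "poly P \<theta> \<noteq> 0"
  shows "order \<theta> p = n"
proof -
  have "p \<noteq> 0" using assms by auto
  then have "order \<theta> p = order \<theta> ([:-\<theta>, 1:] ^ n) + order \<theta> P"
    unfolding assms(1) by (rule order_mult)
  then show ?thesis using assms(2) by (simp add: order_power_n_n order_0I)
qed

lemma order_cofactorE:
  fixes p :: "real poly"
  assumes "p \<noteq> 0"
  obtains P where "p = [:-\<theta>, 1:] ^ order \<theta> p * P" "poly P \<theta> \<noteq> 0"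
  using order_decomp[OF assms, of \<theta>] by (auto simp: poly_eq_0_iff_dvd)

text \<open>Compares the coefficients of the power \<open>2 * n\<close> of
  \<open>x - \<theta>\<close>. Differentiating the two powers gives the factors \<open>n + 1\<close>
  and \<open>n\<close>, whose difference leaves exactly one product of \<open>P\<close> and
  \<open>Q\<close>.\<close>

lemma wronskian_cofactor:
  fixes A B :: "real poly"
  assumes wr: "\<And>x. (poly B x)\<^sup>2 \<le> poly (pderiv A * B - A * pderiv B) x"
    and A: "A = [:-\<theta>, 1:] ^ Suc n * P" and B: "B = [:-\<theta>, 1:] ^ n * Q"
  shows "(poly Q \<theta>)\<^sup>2 \<le> poly P \<theta> * poly Q \<theta>"
proof -
  let ?y = "[:-\<theta>, 1:] :: real poly"
  let ?R = "P * Q - Q ^ 2 + ?y * (pderiv P * Q - P * pderiv Q)"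
  have pw: "pderiv (?y ^ Suc m) = of_nat (Suc m) * ?y ^ m" for m
    unfolding pderiv_power_Suc by (simp add: pderiv_pCons of_nat_poly)
  have dA: "pderiv A = (of_nat n + 1) * ?y ^ n * P + ?y ^ n * ?y * pderiv P"
    unfolding A pderiv_mult pw by (simp add: mult_ac add_ac del: mult_pCons_left mult_pCons_right)
  \<comment> \<open>The extra factor avoids the exponent \<open>n - 1\<close>, which would be wrong
    for \<open>n = 0\<close>; it is available because \<open>A\<close> carries one more
    power.\<close>
  have dB: "?y * pderiv B = of_nat n * ?y ^ n * Q + ?y ^ n * ?y * pderiv Q"
  proof (cases n)
    case (Suc m)
    then show ?thesis
      unfolding B Suc pderiv_mult pw
      by (simp add: algebra_simps del: mult_pCons_left mult_pCons_right)
  qed (simp add: B)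
  have "pderiv A * B - A * pderiv B - B ^ 2 = pderiv A * B - ?y ^ n * P * (?y * pderiv B) - B ^ 2"
    unfolding A by (simp add: mult_ac del: mult_pCons_left mult_pCons_right)
  also have "\<dots> = ?y ^ (2 * n) * ?R"
  proof -
    have "((k + 1) * z * P + z * y * P') * (z * Q) - z * P * (k * z * Q + z * y * Q') - (z * Q) ^ 2
      = z * z * (P * Q - Q ^ 2 + y * (P' * Q - P * Q'))" for k z y P' Q' :: "real poly"
      by algebra
    from this[of "of_nat n" "?y ^ n" ?y "pderiv P" "pderiv Q"] show ?thesis
      unfolding dA dB unfolding B mult_2 power_add .
  qed
  finally have "pderiv A * B - A * pderiv B - B ^ 2 = ?y ^ (2 * n) * ?R" .
  then have "0 \<le> poly (?y ^ (2 * n) * ?R) x" for x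
    using wr[of x] by (metis poly_diff poly_power diff_ge_0_iff_ge)
  then have "0 \<le> poly ?R \<theta>" by (rule nonneg_even_cofactor)
  then show ?thesis by (simp add: power2_eq_square)
qed


lemma nonneg_quadratic_discriminant:
  fixes a b d :: real
  assumes "\<And>c. 0 \<le> a + b * c + d * c\<^sup>2" "0 \<le> d"
  shows "b\<^sup>2 \<le> 4 * a * d"
proof (cases "d = 0")
  case True
  have "b = 0"
  proof (rule ccontr)
    assume "b \<noteq> 0"
    \<comment> \<open>At this argument the affine function takes the value
      \<open>-1\<close>.\<close>
    then show False using assms(1)[of "- (a + 1) / b"] True by simp
  qed
  then show ?thesis using True by simp
next
  case False
  \<comment> \<open>Evaluation at the minimum of the parabola, scaled to clear denominators.\<close>
  have "0 \<le> 4 * d * (a + b * (- b / (2 * d)) + d * (- b / (2 * d))\<^sup>2)"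
    using assms(2) by (intro mult_nonneg_nonneg assms(1)) simp
  also have "\<dots> = 4 * a * d - b\<^sup>2"
    using False by (simp add: field_simps power2_eq_square)
  finally show ?thesis by simp
qed

subsection \<open>Values of rational functions\<close>

text \<open>Evaluates a quotient without computing its reduced form. Cross-multiplication relates
  \<open>P\<close>, \<open>Q\<close> to the coprime pair; neither pair vanishes simultaneously at
  \<open>\<theta>\<close>, so the two denominators vanish there together.\<close>

lemma fract_value_cofactor:
  assumes "p = [:-\<theta>, 1:] ^ n * P" "q = [:-\<theta>, 1:] ^ n * Q" "q \<noteq> 0"
    and "poly P \<theta> \<noteq> 0 \<or> poly Q \<theta> \<noteq> 0"
  shows "fract_value (Fract p q) \<theta> =
    (if poly Q \<theta> = 0 then Infinite else Finite (poly P \<theta> / poly Q \<theta>))"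
proof -
  define u where "u = fst (quot_of_fract (Fract p q))"
  define v where "v = snd (quot_of_fract (Fract p q))"
  have "v \<noteq> 0" "Fract u v = Fract p q" by (simp_all add: u_def v_def)
  then have "u * q = p * v" using assms(3) by (simp add: eq_fract)
  then have "[:-\<theta>, 1:] ^ n * (u * Q) = [:-\<theta>, 1:] ^ n * (P * v)"
    unfolding assms(1,2) by (simp only: mult_ac)
  then have "u * Q = P * v" by simp
  then have eq: "poly u \<theta> * poly Q \<theta> = poly P \<theta> * poly v \<theta>" by (metis poly_mult)
  have val: "fract_value (Fract p q) \<theta> =
      (if poly v \<theta> = 0 then Infinite else Finite (poly u \<theta> / poly v \<theta>))"
    by (simp add: fract_value_def u_def v_def case_prod_unfold Let_def)
  have "coprime u v" unfolding u_def v_def by (rule coprime_quot_of_fract)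
  then have "poly u \<theta> \<noteq> 0 \<or> poly v \<theta> \<noteq> 0"
    using coprime_common_divisor[of u v "[:-\<theta>, 1:]"] by (auto simp: poly_eq_0_iff_dvd[symmetric])
  then have "poly v \<theta> = 0 \<longleftrightarrow> poly Q \<theta> = 0" using eq assms(4) by auto
  then show ?thesis using val eq by (simp add: frac_eq_eq)
qed

text \<open>Translates the zero set into multiplicities: after the smaller power of
  \<open>x - \<theta>\<close> is cancelled, the side of larger order is the one that
  vanishes.\<close>

lemma fract_value_eq_0_iff:
  assumes "p \<noteq> 0" "q \<noteq> 0"
  shows "fract_value (Fract p q) \<theta> = Finite 0 \<longleftrightarrow> order \<theta> q < order \<theta> p"
proof -
  let ?y = "[:-\<theta>, 1:] :: real poly"
  obtain P where P: "p = ?y ^ order \<theta> p * P" "poly P \<theta> \<noteq> 0" using order_cofactorE[OF assms(1)] .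
  obtain Q where Q: "q = ?y ^ order \<theta> q * Q" "poly Q \<theta> \<noteq> 0" using order_cofactorE[OF assms(2)] .
  show ?thesis
  proof (cases "order \<theta> q \<le> order \<theta> p")
    case True
    then have "p = ?y ^ order \<theta> q * (?y ^ (order \<theta> p - order \<theta> q) * P)"
      using P(1) by (simp add: mult.assoc[symmetric] power_add[symmetric])
    from fract_value_cofactor[OF this Q(1) assms(2)] show ?thesis
      using P(2) Q(2) True by (auto simp: power_0_left)
  next
    case False
    then have "q = ?y ^ order \<theta> p * (?y ^ (order \<theta> q - order \<theta> p) * Q)"
      using Q(1) by (simp add: mult.assoc[symmetric] power_add[symmetric])
    from fract_value_cofactor[OF P(1) this assms(2)] show ?thesis
      using P(2) False by auto
  qed
qed

lemma fract_value_eq_Infinite: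
  assumes "p \<noteq> 0" "q \<noteq> 0" "order \<theta> p < order \<theta> q"
  shows "fract_value (Fract p q) \<theta> = Infinite"
proof -
  let ?y = "[:-\<theta>, 1:] :: real poly"
  obtain P where P: "p = ?y ^ order \<theta> p * P" "poly P \<theta> \<noteq> 0" using order_cofactorE[OF assms(1)] .
  obtain Q where Q: "q = ?y ^ order \<theta> q * Q" using order_cofactorE[OF assms(2)] .
  then have "q = ?y ^ order \<theta> p * (?y ^ (order \<theta> q - order \<theta> p) * Q)"
    using assms(3) by (simp add: mult.assoc[symmetric] power_add[symmetric])
  from fract_value_cofactor[OF P(1) this assms(2)] show ?thesis
    using P(2) assms(3) by auto
qed

subsection \<open>Multiplicities under vertex deletion\<close>

context matching_weights
begin

context
  fixes r :: "nat \<Rightarrow> real" and \<theta> :: real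
begin

abbreviation "f \<equiv> mu w r"
abbreviation "ord S \<equiv> order \<theta> (f S)"
abbreviation "y \<equiv> [:-\<theta>, 1:] :: real poly"

lemma f_nonzero: "S \<subseteq> V \<Longrightarrow> f S \<noteq> 0"
  using mu_nonzero finite_sub by blast

lemma dvd_f_iff: "S \<subseteq> V \<Longrightarrow> y ^ n dvd f S \<longleftrightarrow> n \<le> ord S"
  using f_nonzero order_divides by blast

lemma cofactorE:
  assumes "S \<subseteq> V" "n \<le> ord S"
  obtains P where "f S = y ^ n * P"
  using assms dvd_f_iff by (meson dvdE)

lemma exact_cofactorE:
  assumes "S \<subseteq> V" "ord S = n"
  obtains P where "f S = y ^ n * P" "poly P \<theta> \<noteq> 0"
  using order_cofactorE[OF f_nonzero[OF assms(1)], of \<theta>] assms(2) by blast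

text \<open>A local form of interlacing: if \<open>Q\<close> does not vanish at
  \<open>\<theta>\<close>, then neither does \<open>P\<close>, and both have the same sign
  there.\<close>

lemma lead_sign:
  assumes "S \<subseteq> V" "v \<in> S" "f S = y ^ Suc n * P" "f (S - {v}) = y ^ n * Q"
  shows "(poly Q \<theta>)\<^sup>2 \<le> poly P \<theta> * poly Q \<theta>"
  using wronskian_cofactor[OF wronskian[OF assms(1,2)] assms(3,4)] .

text \<open>A drop by two or more would make the numerator cofactor in \<open>lead_sign\<close>
  vanish at \<open>\<theta>\<close>, forcing the nonzero one to vanish as well.\<close>

lemma ord_le_Suc_del:
  assumes "S \<subseteq> V" "v \<in> S"
  shows "ord S \<le> Suc (ord (S - {v}))"
proof (rule ccontr)
  define n where "n = ord (S - {v})"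
  assume "\<not> ?thesis"
  then have "Suc (Suc n) \<le> ord S" by (simp add: n_def)
  then obtain P where "f S = y ^ Suc (Suc n) * P" using assms cofactorE by blast
  then have P: "f S = y ^ Suc n * (y * P)" by (simp add: mult_ac del: mult_pCons_left mult_pCons_right)
  have "S - {v} \<subseteq> V" using assms by auto
  then obtain Q where Q: "f (S - {v}) = y ^ n * Q" "poly Q \<theta> \<noteq> 0"
    using exact_cofactorE n_def by blast
  show False using lead_sign[OF assms P Q(1)] Q(2) by simp
qed

text \<open>If \<open>S - {v}\<close> has multiplicity \<open>n + 1\<close>, then each
  \<open>S - {v, l}\<close> has at least \<open>n\<close>, so every term of the expansion at
  \<open>v\<close> is divisible by \<open>y ^ n\<close>.\<close>

lemma ord_del_le_Suc:
  assumes "S \<subseteq> V" "v \<in> S"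
  shows "ord (S - {v}) \<le> Suc (ord S)"
proof (cases "ord (S - {v})")
  case (Suc n)
  have "y ^ n dvd f (S - {v})" using assms Suc by (subst dvd_f_iff) auto
  moreover have "y ^ n dvd f (S - {v, l})" if "l \<in> S - {v}" for l
  proof -
    have "ord (S - {v}) \<le> Suc (ord (S - {v} - {l}))"
      using assms that by (intro ord_le_Suc_del) auto
    then show ?thesis
      using assms Suc by (subst dvd_f_iff) (auto simp: Diff_insert2[symmetric] insert_commute)
  qed
  ultimately have "y ^ n dvd f S"
    unfolding mu_expand[OF finite_sub[OF assms(1)] assms(2)]
    by (intro dvd_add dvd_sum dvd_mult) auto
  then show ?thesis using assms Suc dvd_f_iff by simp
qed simp

text \<open>The leading terms of all summands in the expansion at \<open>i\<close> have the same sign.\<close>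

lemma ord_add_vertex:
  assumes "S \<subseteq> V" "i \<in> S" "l \<in> S - {i}" "w {i, l} \<noteq> 0" "ord (S - {i}) = Suc (ord (S - {i, l}))"
  shows "ord (S - {i}) = Suc (ord S)"
proof -
  define n where "n = ord (S - {i, l})"
  have fin: "finite S" using assms finite_sub by blast
  have "S - {i} \<subseteq> V" using assms by auto
  then obtain P where P: "f (S - {i}) = y ^ Suc n * P" "poly P \<theta> \<noteq> 0"
    using exact_cofactorE[of "S - {i}" "Suc n"] assms by (auto simp: n_def)
  have "\<exists>Q. f (S - {i, s}) = y ^ n * Q" if "s \<in> S - {i}" for s
  proof -
    have "ord (S - {i}) \<le> Suc (ord (S - {i} - {s}))"
      using assms that by (intro ord_le_Suc_del) auto
    then have "n \<le> ord (S - {i, s})"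
      using assms by (simp add: n_def Diff_insert2[symmetric] insert_commute)
    then show ?thesis using assms cofactorE[of "S - {i, s}" n] by blast
  qed
  then obtain Q where Q: "\<And>s. s \<in> S - {i} \<Longrightarrow> f (S - {i, s}) = y ^ n * Q s" by metis
  have sgn: "(poly (Q s) \<theta>)\<^sup>2 \<le> poly P \<theta> * poly (Q s) \<theta>" if "s \<in> S - {i}" for s
    using lead_sign[of "S - {i}" s n P "Q s"] Q[OF that] P assms that
    by (auto simp: Diff_insert2[symmetric] insert_commute)
  have "S - {i, l} \<subseteq> V" using assms by auto
  then obtain Q' where Q': "f (S - {i, l}) = y ^ n * Q'" "poly Q' \<theta> \<noteq> 0"
    using exact_cofactorE n_def by blast
  then have Ql: "poly (Q l) \<theta> \<noteq> 0" using Q[OF assms(3)] by simp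
  \<comment> \<open>The cofactor of \<open>y ^ n\<close> in \<open>f S\<close>. The vertex term
    keeps a factor \<open>y\<close>, since \<open>f (S - {i})\<close> has order
    \<open>n + 1\<close>, and so vanishes at \<open>\<theta>\<close>.\<close>
  define R where "R = [:- r i, 1:] * y * P + (\<Sum>s\<in>S - {i}. [:w {i, s}:] * Q s)"
  have fS: "f S = y ^ n * R"
    unfolding mu_expand[OF fin assms(2)] R_def P(1) distrib_left sum_distrib_left using Q
    by (simp add: mult_ac del: mult_pCons_left mult_pCons_right)
  \<comment> \<open>Multiplying by the value of \<open>P\<close> turns all summands nonpositive by
    \<open>lead_sign\<close>; the summand at \<open>l\<close> is strictly negative.\<close>
  have "poly P \<theta> * poly R \<theta> = (\<Sum>s\<in>S - {i}. w {i, s} * (poly P \<theta> * poly (Q s) \<theta>))"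
  proof -
    have "poly ([:- r i, 1:] * y * P) \<theta> = 0" unfolding poly_mult by simp
    then show ?thesis unfolding R_def poly_add by (simp add: poly_sum sum_distrib_left mult_ac)
  qed
  also have "\<dots> < 0"
  proof -
    have pos: "0 \<le> poly P \<theta> * poly (Q s) \<theta>" if "s \<in> S - {i}" for s
      using sgn[OF that] zero_le_power2 order_trans by blast
    have "w {i, s} * (poly P \<theta> * poly (Q s) \<theta>) \<le> 0" if "s \<in> S - {i}" for s
      using pos[OF that] nonpos[of i s] that assms by (intro mult_nonpos_nonneg) auto
    moreover have "0 < poly P \<theta> * poly (Q l) \<theta>" using pos[OF assms(3)] P(2) Ql by (simp add: less_le)
    then have "w {i, l} * (poly P \<theta> * poly (Q l) \<theta>) < 0"
      using nonpos[of i l] assms by (intro mult_neg_pos) (auto simp: less_le)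
    ultimately have "(\<Sum>s\<in>S - {i}. w {i, s} * (poly P \<theta> * poly (Q s) \<theta>)) < (\<Sum>s\<in>S - {i}. 0)"
      using fin assms(3) by (intro sum_strict_mono_ex1) auto
    then show ?thesis by simp
  qed
  finally have "poly R \<theta> \<noteq> 0" by auto
  then show ?thesis using order_eq_cofactor[OF fS] assms(5) by (simp add: n_def)
qed

lemma rayleigh_poly:
  assumes "S \<subseteq> V" "k \<in> S" "l \<in> S" "k \<noteq> l"
  shows "0 \<le> poly (f (S - {k}) * f (S - {l}) - f S * f (S - {k, l})) x"
  using rayleigh[OF assms, of r x] by simp

text \<open>
  The Rayleigh inequality for \<open>k, l\<close> holds for every value of \<open>r j\<close>, and is quadratic in it;
  otherwise its discriminant would be positive near \<open>\<theta>\<close>.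
\<close>

lemma exchange:
  assumes "S \<subseteq> V" "j \<in> S" "k \<in> S" "l \<in> S" "j \<noteq> k" "j \<noteq> l" "k \<noteq> l"
    and "ord S = N + 2" "ord (S - {j}) = N + 1" "ord (S - {k, l}) = N"
  shows "ord (S - {j, k}) = N \<or> ord (S - {j, l}) = N"
proof (rule ccontr)
  assume contra: "\<not> ?thesis"
  have fin: "finite S" using assms finite_sub by blast
  have del: "ord T \<le> Suc (ord (T - {v}))" if "T \<subseteq> S" "v \<in> T" for T v
    using that assms by (intro ord_le_Suc_del) auto
  have sets: "S - {j} - {k} = S - {j, k}" "S - {j} - {l} = S - {j, l}"
    "S - {j, k} - {l} = S - {j, k, l}" by auto
  \<comment> \<open>The negated claim enters here: deleting neither \<open>k\<close> nor
    \<open>l\<close> lowers the multiplicity of \<open>S - {j}\<close>.\<close>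
  have ords: "N + 1 \<le> ord (S - {k})" "N + 1 \<le> ord (S - {l})"
    "N + 1 \<le> ord (S - {j, k})" "N + 1 \<le> ord (S - {j, l})" "N \<le> ord (S - {j, k, l})"
    using del[of S k] del[of S l] del[of "S - {j}" k] del[of "S - {j}" l] del[of "S - {j, k}" l]
      assms contra by (auto simp: sets)
  have sub: "S - T \<subseteq> V" for T using assms by auto
  obtain F where F: "f S = y ^ (N + 2) * F" using cofactorE assms by (metis order_refl)
  obtain Fj where Fj: "f (S - {j}) = y ^ (N + 1) * Fj" "poly Fj \<theta> \<noteq> 0"
    using exact_cofactorE[OF sub assms(9)] .
  obtain Fkl where Fkl: "f (S - {k, l}) = y ^ N * Fkl" "poly Fkl \<theta> \<noteq> 0"
    using exact_cofactorE[OF sub assms(10)] .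
  obtain Fk where Fk: "f (S - {k}) = y ^ (N + 1) * Fk" using cofactorE[OF sub ords(1)] .
  obtain Fl where Fl: "f (S - {l}) = y ^ (N + 1) * Fl" using cofactorE[OF sub ords(2)] .
  obtain Fjk where Fjk: "f (S - {j, k}) = y ^ (N + 1) * Fjk" using cofactorE[OF sub ords(3)] .
  obtain Fjl where Fjl: "f (S - {j, l}) = y ^ (N + 1) * Fjl" using cofactorE[OF sub ords(4)] .
  obtain Fjkl where Fjkl: "f (S - {j, k, l}) = y ^ N * Fjkl" using cofactorE[OF sub ords(5)] .
  \<comment> \<open>\<open>A\<close>, \<open>B\<close>, \<open>C\<close> are the coefficients of the
    Rayleigh difference for \<open>k, l\<close> as a quadratic in \<open>c\<close>, where
    \<open>r j\<close> is replaced by \<open>r j - c\<close>.\<close>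
  define A where "A = f (S - {k}) * f (S - {l}) - f S * f (S - {k, l})"
  define B where "B = f (S - {k}) * f (S - {j, l}) + f (S - {j, k}) * f (S - {l})
    - f (S - {j}) * f (S - {k, l}) - f S * f (S - {j, k, l})"
  define C where "C = f (S - {j, k}) * f (S - {j, l}) - f (S - {j}) * f (S - {j, k, l})"
  \<comment> \<open>Cofactors after the powers of \<open>y\<close> with exponents
    \<open>2 * N + 2\<close>, \<open>2 * N + 1\<close> and \<open>2 * N + 1\<close> are removed from
    \<open>A\<close>, \<open>B\<close>, \<open>C\<close>; thus the product \<open>A * C\<close> has
    one power more than the square of \<open>B\<close>.\<close>
  define A' where "A' = Fk * Fl - F * Fkl"
  define B' where "B' = y * Fk * Fjl + y * Fjk * Fl - Fj * Fkl - y * F * Fjkl"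
  define C' where "C' = y * Fjk * Fjl - Fj * Fjkl"
  define R where "R = 4 * y * A' * C' - B' ^ 2"
  have "4 * A * C - B ^ 2 = y ^ (2 * (2 * N + 1)) * R"
  proof -
    define z where "z = y ^ N"
    define t where "t = y"
    have z: "y ^ N = z" "y ^ (N + 1) = z * t" "y ^ (N + 2) = z * t * t"
      by (simp_all add: z_def t_def power_add power2_eq_square mult_ac
          del: mult_pCons_left mult_pCons_right)
    have "y ^ (2 * (2 * N + 1)) = (y ^ (N + N + 1)) ^ 2"
      unfolding power_mult[symmetric] by (rule arg_cong[where f = "power y"]) simp
    also have "\<dots> = (z * z * t) ^ 2" by (simp add: z_def t_def power_add mult_ac
          del: mult_pCons_left mult_pCons_right)
    finally have z2: "y ^ (2 * (2 * N + 1)) = (z * z * t) ^ 2" .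
    have "A = z * z * t * t * A'" "B = z * z * t * B'" "C = z * z * t * C'"
      unfolding A_def B_def C_def A'_def B'_def C'_def F Fj(1) Fk Fl Fkl(1) Fjk Fjl Fjkl z
      unfolding t_def[symmetric] by (simp_all add: algebra_simps)
    then show ?thesis
      unfolding R_def z2 unfolding t_def[symmetric] by (simp add: algebra_simps power2_eq_square)
  qed
  moreover have "(poly B x)\<^sup>2 \<le> 4 * poly A x * poly C x" for x
  proof (rule nonneg_quadratic_discriminant)
    show "0 \<le> poly C x"
      using rayleigh_poly[of "S - {j}" k l x] assms
      by (auto simp: C_def sets Diff_insert2[symmetric] insert_commute)
    fix c
    have "mu w (r(j := r j - c)) (S - T) = f (S - T) + [:c:] * f (S - insert j T)" if "j \<notin> T" for T
    proof -
      have "S - T - {j} = S - insert j T" by auto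
      then show ?thesis using mu_root_shift[of "S - T" w r j c] fin assms that by simp
    qed
    note shift = this[of "{}", simplified] this[of "{k}"] this[of "{l}"] this[of "{k, l}"]
    show "0 \<le> poly A x + poly B x * c + poly C x * c\<^sup>2"
      using rayleigh[of S k l "r(j := r j - c)" x] assms shift
      by (simp add: A_def B_def C_def algebra_simps power2_eq_square)
  qed
  then have "0 \<le> poly (4 * A * C - B ^ 2) x" for x by simp
  ultimately have "0 \<le> poly R \<theta>" using nonneg_even_cofactor by metis
  \<comment> \<open>At \<open>\<theta>\<close> only the square of \<open>Fj * Fkl\<close> survives
    in \<open>R\<close>, with a minus sign.\<close>
  then show False using Fj(2) Fkl(2) by (simp add: R_def B'_def)
qed

section \<open>Deleting a vertex on the frontier of the zero set\<close>

text \<open>By parity: a nonnegative polynomial cannot vanish to the odd order \<open>2 * ord S - 1\<close>.\<close>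

lemma frontier_ord:
  assumes "S \<subseteq> V" "i \<in> S" "k \<in> S" "i \<noteq> k" "w {i, k} \<noteq> 0"
    and "ord S = Suc (ord (S - {k}))" "ord S \<le> ord (S - {i})"
  shows "ord (S - {i}) = Suc (ord S)" "ord (S - {i, k}) = ord S"
proof -
  define p where "p = ord (S - {k})"
  have sets: "S - {i} - {k} = S - {i, k}" "S - {k} - {i} = S - {i, k}" by auto
  have sub: "S - T \<subseteq> V" for T using assms by auto
  have ik: "ord (S - {i, k}) \<le> Suc p" "ord (S - {i}) \<le> Suc (ord (S - {i, k}))"
    using ord_del_le_Suc[OF sub, of i "{k}"] ord_le_Suc_del[OF sub, of k "{i}"] assms(2-4)
    unfolding sets p_def by auto
  have S: "ord S = Suc p" using assms by (simp add: p_def)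
  have "ord (S - {i}) \<noteq> Suc p"
  proof
    assume i: "ord (S - {i}) = Suc p"
    \<comment> \<open>Otherwise \<open>k\<close> would lower the multiplicity of
      \<open>S - {i}\<close>, and \<open>ord_add_vertex\<close> would make the deletion of
      \<open>i\<close> raise that of \<open>S\<close>.\<close>
    have "ord (S - {i, k}) \<noteq> p"
    proof
      assume "ord (S - {i, k}) = p"
      with i have "ord (S - {i}) = Suc (ord (S - {i, k}))" by (simp only:)
      moreover have "k \<in> S - {i}" using assms(3,4) by simp
      ultimately have "ord (S - {i}) = Suc (ord S)" using ord_add_vertex assms(1,2,5) by blast
      then show False using i S by linarith
    qed
    \<comment> \<open>Now \<open>f S * f (S - {i, k})\<close> vanishes to order at least
      \<open>2 * p + 2\<close>, but \<open>f (S - {i}) * f (S - {k})\<close> to order exactly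
      \<open>2 * p + 1\<close>, which is odd.\<close>
    then have "Suc p \<le> ord (S - {i, k})" using ik i by simp
    then obtain E where E: "f (S - {i, k}) = y ^ Suc p * E" using cofactorE[OF sub] by blast
    obtain F where F: "f S = y ^ Suc p * F" using cofactorE[OF assms(1)] S by (metis order_refl)
    obtain P where P: "f (S - {i}) = y ^ Suc p * P" "poly P \<theta> \<noteq> 0"
      using exact_cofactorE[OF sub i] .
    obtain Q where Q: "f (S - {k}) = y ^ p * Q" "poly Q \<theta> \<noteq> 0"
      using exact_cofactorE[OF sub p_def[symmetric]] .
    have "f (S - {i}) * f (S - {k}) - f S * f (S - {i, k}) = y ^ (2 * p + 1) * (P * Q - y * F * E)"
      unfolding E F P(1) Q(1) right_diff_distrib
      unfolding mult_2 power_add by (simp add: mult_ac del: mult_pCons_left mult_pCons_right)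
    then have "0 \<le> poly (y ^ (2 * p + 1) * (P * Q - y * F * E)) x" for x
      using rayleigh_poly[of S i k x] assms by simp
    then have "poly (P * Q - y * F * E) \<theta> = 0" by (rule nonneg_odd_cofactor)
    then show False using P Q by simp
  qed
  moreover have "ord (S - {i}) \<le> Suc (ord S)" using ord_del_le_Suc assms by blast
  ultimately show "ord (S - {i}) = Suc (ord S)" using S assms by linarith
  then show "ord (S - {i, k}) = ord S" using ik S by linarith
qed

text \<open>It suffices to find a neighbor \<open>t\<close> of \<open>i\<close>, other than
  \<open>j\<close>, whose deletion lowers the multiplicity of \<open>S - {i, j}\<close>: then
  \<open>ord_add_vertex\<close> shows that deleting \<open>i\<close> from \<open>S - {j}\<close>
  raises the multiplicity by one.\<close>

lemma frontier_zero_transfer: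
  assumes "S \<subseteq> V" "i \<in> S" "k \<in> S" "i \<noteq> k" "w {i, k} \<noteq> 0"
    and "ord S = Suc (ord (S - {k}))" "ord S \<le> ord (S - {i})"
    and "j \<in> S" "j \<noteq> i" "ord (S - {i}) = Suc (ord (S - {i, j}))"
  shows "ord S = Suc (ord (S - {j}))"
proof -
  define p where "p = ord (S - {k})"
  have sub: "S - T \<subseteq> V" for T using assms by auto
  have fin: "finite S" using assms finite_sub by blast
  note fr = frontier_ord[OF assms(1-7)]
  have ords: "ord S = p + 1" "ord (S - {i}) = p + 2" "ord (S - {i, k}) = p + 1"
    "ord (S - {i, j}) = p + 1"
    using fr assms(6,10) unfolding p_def by linarith+
  \<comment> \<open>If no such neighbor existed, every term in the expansion of
    \<open>f (S - {k})\<close> at \<open>i\<close> would be divisible by \<open>y ^ (p + 1)\<close>,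
    against \<open>ord (S - {k}) = p\<close>.\<close>
  have "\<exists>l\<in>S - {k} - {i}. w {i, l} \<noteq> 0 \<and> ord (S - {k} - {i, l}) \<le> p"
  proof (rule ccontr)
    assume "\<not> ?thesis"
    then have "w {i, l} = 0 \<or> p + 1 \<le> ord (S - {k} - {i, l})" if "l \<in> S - {k} - {i}" for l
      using that by fastforce
    moreover have "S - {k} - {i, l} \<subseteq> V" for l using assms by auto
    ultimately have "y ^ (p + 1) dvd [:w {i, l}:] * f (S - {k} - {i, l})"
      if "l \<in> S - {k} - {i}" for l
      using that by (metis dvd_f_iff dvd_mult dvd_0_right mult_zero_left pCons_0_0)
    moreover have "S - {k} - {i} = S - {i, k}" by auto
    then have "y ^ (p + 1) dvd f (S - {k} - {i})"
      using ords dvd_f_iff[OF sub, of "p + 1" "{i, k}"] by simp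
    moreover have "f (S - {k}) = [:- r i, 1:] * f (S - {k} - {i})
        + (\<Sum>l\<in>S - {k} - {i}. [:w {i, l}:] * f (S - {k} - {i, l}))"
      using fin assms by (intro mu_expand) auto
    ultimately have "y ^ (p + 1) dvd f (S - {k})"
      by (metis (no_types, lifting) dvd_add dvd_mult dvd_sum)
    then have "p + 1 \<le> ord (S - {k})" using dvd_f_iff[OF sub] by blast
    then show False by (simp add: p_def)
  qed
  then obtain l where l: "l \<in> S" "l \<noteq> k" "l \<noteq> i" "w {i, l} \<noteq> 0" "ord (S - {k} - {i, l}) \<le> p"
    by auto
  have ikl: "S - {k} - {i, l} = S - {i} - {k, l}" "S - {i, k} - {l} = S - {i} - {k, l}"
    "S - {l} - {i, k} = S - {i} - {k, l}" by auto
  have "ord (S - {i, k}) \<le> Suc (ord (S - {i, k} - {l}))"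
    using l(1-3) by (intro ord_le_Suc_del[OF sub]) auto
  then have kl: "ord (S - {i} - {k, l}) = p" using ords l by (simp add: ikl)
  have "\<exists>t\<in>S - {i, j}. w {i, t} \<noteq> 0 \<and> ord (S - {j} - {i, t}) = p"
  proof (cases "j = k \<or> j = l")
    case True
    then show ?thesis
    proof
      assume "j = k"
      then show ?thesis using l(1-4) kl by (intro bexI[of _ l]) (auto simp: ikl)
    next
      assume "j = l"
      then show ?thesis using assms(3-5) l(2) kl by (intro bexI[of _ k]) (auto simp: ikl)
    qed
  next
    case False
    have ijt: "S - {j} - {i, t} = S - {i} - {j, t}" for t by auto
    have "S - {i} - {j} = S - {i, j}" by auto
    \<comment> \<open>\<open>exchange\<close> inside \<open>S - {i}\<close> with
      \<open>N = p\<close>: one of the two independent neighbors \<open>k\<close>, \<open>l\<close>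
      is also independent of \<open>j\<close>, and serves as \<open>t\<close>.\<close>
    then have "ord (S - {i} - {j, k}) = p \<or> ord (S - {i} - {j, l}) = p"
      using False l(1-3) assms(3,4,8,9) ords(2,4) kl by (intro exchange[OF sub]) auto
    then show ?thesis using False l(1,3,4) assms(3-5) unfolding ijt by auto
  qed
  then obtain t where t: "t \<in> S" "t \<noteq> i" "t \<noteq> j" "w {i, t} \<noteq> 0" "ord (S - {j} - {i, t}) = p"
    by auto
  have ij: "S - {j} - {i} = S - {i, j}" by auto
  have "ord (S - {j} - {i}) = Suc (ord (S - {j}))"
  proof (rule ord_add_vertex[OF sub])
    show "ord (S - {j} - {i}) = Suc (ord (S - {j} - {i, t}))"
      unfolding ij using t(5) ords(4) by simp
  qed (use t assms(2,9) in auto)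
  then show ?thesis unfolding ij using ords(1,4) by simp
qed

text \<open>If \<open>j\<close> lowers the multiplicity of \<open>S - {i}\<close>, both values are
  zero by \<open>frontier_zero_transfer\<close>. Otherwise the Rayleigh difference for
  \<open>i, j\<close> is divisible by an odd power of \<open>y\<close>, and parity kills its leading
  coefficient.\<close>

lemma frontier_value:
  assumes "S \<subseteq> V" "i \<in> S" "k \<in> S" "i \<noteq> k" "w {i, k} \<noteq> 0"
    and "ord S = Suc (ord (S - {k}))" "ord S \<le> ord (S - {i})"
    and "j \<in> S" "j \<noteq> i"
  shows "fract_value (Fract (f (S - {i})) (f (S - {i, j}))) \<theta> = fract_value (Fract (f S) (f (S - {j}))) \<theta>"
proof -
  define m where "m = ord S"
  note fr = frontier_ord(1)[OF assms(1-7)]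
  have sub: "S - T \<subseteq> V" for T using assms by auto
  have nz: "f S \<noteq> 0" "f (S - T) \<noteq> 0" for T
    using f_nonzero[OF assms(1)] f_nonzero[OF sub] by auto
  have sets: "S - {i} - {j} = S - {i, j}" "S - {j} - {i} = S - {i, j}" by auto
  have j: "ord S \<le> Suc (ord (S - {j}))"
    "ord (S - {i}) \<le> Suc (ord (S - {i, j}))"
    "ord (S - {i, j}) \<le> Suc (ord (S - {j}))"
    using ord_le_Suc_del[OF assms(1), of j] ord_le_Suc_del[OF sub, of j "{i}"]
      ord_del_le_Suc[OF sub, of i "{j}"] assms by (auto simp: sets)
  show ?thesis
  proof (cases "ord (S - {i}) = Suc (ord (S - {i, j}))")
    case True
    then have "ord S = Suc (ord (S - {j}))"
      using frontier_zero_transfer[OF assms(1-9)] by simp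
    then show ?thesis
      using True fract_value_eq_0_iff[OF nz(2)[of "{i}"] nz(2)[of "{i, j}"], of \<theta>]
        fract_value_eq_0_iff[OF nz(1) nz(2)[of "{j}"], of \<theta>] by simp
  next
    case False
    \<comment> \<open>The first bound is the case assumption; the second follows because deleting
      \<open>i\<close> from \<open>S - {j}\<close> raises the multiplicity by at most one.\<close>
    then have ords: "m + 1 \<le> ord (S - {i, j})" "m \<le> ord (S - {j})"
      using j fr by (auto simp: m_def)
    obtain E where E: "f (S - {i, j}) = y ^ (m + 1) * E"
      using cofactorE[OF sub ords(1)] .
    obtain Q where Q: "f (S - {j}) = y ^ m * Q"
      using cofactorE[OF sub ords(2)] .
    obtain P where P: "f (S - {i}) = y ^ (m + 1) * P" "poly P \<theta> \<noteq> 0"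
      using order_cofactorE[OF nz(2)[of "{i}"], of \<theta>] fr by (auto simp: m_def)
    obtain F where F: "f S = y ^ m * F" "poly F \<theta> \<noteq> 0"
      using order_cofactorE[OF nz(1), of \<theta>] by (auto simp: m_def)
    have "f (S - {i}) * f (S - {j}) - f S * f (S - {i, j}) = y ^ (2 * m + 1) * (P * Q - F * E)"
      unfolding E F(1) P(1) Q right_diff_distrib
      unfolding mult_2 power_add by (simp add: mult_ac del: mult_pCons_left mult_pCons_right)
    then have "0 \<le> poly (y ^ (2 * m + 1) * (P * Q - F * E)) x" for x
      using rayleigh_poly[of S i j x] assms by simp
    then have "poly (P * Q - F * E) \<theta> = 0" by (rule nonneg_odd_cofactor)
    then have eq: "poly P \<theta> * poly Q \<theta> = poly F \<theta> * poly E \<theta>" by simp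
    \<comment> \<open>Both denominators may vanish here, and then both values are
      \<open>Infinite\<close>; otherwise \<open>eq\<close> is the equality of the quotients by
      cross-multiplication.\<close>
    then have "poly Q \<theta> = 0 \<longleftrightarrow> poly E \<theta> = 0" using P(2) F(2) by auto
    then show ?thesis
      using fract_value_cofactor[OF P(1) E nz(2)] fract_value_cofactor[OF F(1) Q nz(2)] P(2) F(2) eq
      by (simp add: frac_eq_eq)
  qed
qed

end

end

section \<open>From multiplicities back to values and vertex classes of the graph\<close>

theorem theorem3p17:
  fixes n :: nat and G :: wgraph and \<theta> :: real and i :: nat
  assumes "weighted_graph n G"
    and "i \<in> vertex_frontier G (zero_set \<theta> G)"
  shows "(\<forall>j\<in>verts G. j \<noteq> i \<longrightarrow>
            fract_value (alpha (del_verts G {i}) j) \<theta> = fract_value (alpha G j) \<theta> \<and>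
            fract_value (Fract (matching_poly (del_verts G {i})) (matching_poly (del_verts G {i, j}))) \<theta>
              = fract_value (Fract (matching_poly G) (matching_poly (del_verts G {j}))) \<theta>) \<and>
         neg_set \<theta> (del_verts G {i}) = neg_set \<theta> G \<and>
         zero_set \<theta> (del_verts G {i}) = zero_set \<theta> G \<and>
         pos_set \<theta> (del_verts G {i}) = pos_set \<theta> G \<and>
         inf_set \<theta> (del_verts G {i}) = inf_set \<theta> G - {i}"
proof -
  define V where "V = verts G"
  define f where "f = mu (pair_weight G) (root G)"
  interpret M: matching_weights V "pair_weight G"
    using assms(1) by unfold_locales (auto simp: weighted_graph_def V_def)
  have nz: "f V \<noteq> 0" "f (V - T) \<noteq> 0" for T
    using mu_nonzero[of V] mu_nonzero[of "V - T"] M.finite_V by (auto simp: f_def)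
  have alpha: "alpha G j = Fract (f V) (f (V - {j}))" for j
    by (simp add: alpha_def matching_poly_conv_mu matching_poly_del_verts f_def V_def del_verts_def)
  have alpha_del: "alpha (del_verts G {i}) j = Fract (f (V - {i})) (f (V - {i, j}))" for j
    by (simp add: alpha_def matching_poly_conv_mu f_def V_def del_verts_def
        Diff_insert2[symmetric] insert_commute)
  have zero: "j \<in> zero_set \<theta> G \<longleftrightarrow> j \<in> V \<and> order \<theta> (f (V - {j})) < order \<theta> (f V)" for j
    unfolding zero_set_def alpha using fract_value_eq_0_iff[OF nz] by (simp add: V_def)
  obtain k where k: "k \<in> zero_set \<theta> G" "neighbors G i k" and i: "i \<in> V" "i \<notin> zero_set \<theta> G"
    using assms(2) by (auto simp: vertex_frontier_def V_def)
  then have k': "k \<in> V" "i \<noteq> k" "pair_weight G {i, k} \<noteq> 0" by (auto simp: neighbors_def V_def)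
  \<comment> \<open>Membership in the zero set gives a strict drop, and one deletion cannot lower
    the multiplicity by more than one.\<close>
  have ord_k: "order \<theta> (f V) = Suc (order \<theta> (f (V - {k})))"
    using k k' zero M.ord_le_Suc_del[of V k \<theta> "root G"] by (simp add: f_def)
  have ord_i: "order \<theta> (f V) \<le> order \<theta> (f (V - {i}))" using i zero by auto
  note fr = order_refl[of V] i(1) k' ord_k[unfolded f_def] ord_i[unfolded f_def]
  have value_eq: "fract_value (Fract (f (V - {i})) (f (V - {i, j}))) \<theta> =
      fract_value (Fract (f V) (f (V - {j}))) \<theta>" if "j \<in> V" "j \<noteq> i" for j
    unfolding f_def using M.frontier_value[OF fr that] .
  then have eq: "fract_value (alpha (del_verts G {i}) j) \<theta> = fract_value (alpha G j) \<theta>"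
    if "j \<in> verts G" "j \<noteq> i" for j
    using that by (simp add: alpha alpha_del V_def)
  have "order \<theta> (f V) < order \<theta> (f (V - {i}))"
    using M.frontier_ord(1)[OF fr] by (simp add: f_def)
  \<comment> \<open>So \<open>i\<close> lies in the infinite set of \<open>G\<close> and in none of
    the other three, which is why only that set loses an element.\<close>
  then have inf: "fract_value (alpha G i) \<theta> = Infinite"
    unfolding alpha by (rule fract_value_eq_Infinite[OF nz])
  then have ne: "j \<noteq> i" if "fract_value (alpha G j) \<theta> = Finite a" for j a
    using that by auto
  have verts: "verts (del_verts G {i}) = verts G - {i}" by (simp add: del_verts_def)
  have "\<forall>j\<in>verts G. j \<noteq> i \<longrightarrow>
      fract_value (alpha (del_verts G {i}) j) \<theta> = fract_value (alpha G j) \<theta> \<and>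
      fract_value (Fract (matching_poly (del_verts G {i})) (matching_poly (del_verts G {i, j}))) \<theta>
        = fract_value (Fract (matching_poly G) (matching_poly (del_verts G {j}))) \<theta>"
    using eq value_eq
    by (simp add: matching_poly_del_verts matching_poly_conv_mu[of G] f_def V_def)
  moreover have "neg_set \<theta> (del_verts G {i}) = neg_set \<theta> G"
    using eq ne unfolding neg_set_def verts by fastforce
  moreover have "zero_set \<theta> (del_verts G {i}) = zero_set \<theta> G"
    using eq ne unfolding zero_set_def verts by fastforce
  moreover have "pos_set \<theta> (del_verts G {i}) = pos_set \<theta> G"
    using eq ne unfolding pos_set_def verts by fastforce
  moreover have "inf_set \<theta> (del_verts G {i}) = inf_set \<theta> G - {i}"
    using eq unfolding inf_set_def verts by auto
  ultimately show ?thesis by blast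
qed

end
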